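(* Let $A$ be a unital C*-algebra and $D\subseteq A$ a unital commutative sub-C*-algebra, and assume that $\mathrm{T}(A)$ is a Bauer simplex. Let $n\in\mathbb N$ and let $p_1,\dots,p_n\in(\ell^\infty(D)/J_{2,\omega,\mathrm{T}(A)|_D})\cap A'$ be a partition of unity such that $\tau(p_i)=\frac1n$ for all $\tau\in\mathrm{T}(A)_\omega$ and $i=1,\dots,n$. Then $\tau(p_iap_i)=\frac1n\tau(a)$ for all $a\in A$, $\tau\in\mathrm{T}(A)_\omega$, $i=1,\dots,n$.
   Context: $\mathrm{T}(A)$ is the set of tracial states of $A$; a Bauer simplex is a Choquet simplex with closed set of extreme points. $\omega$ is a free ultrafilter on $\mathbb N$. For a C*-algebra $B$ and a set $\Delta$ of tracial states, $J_{2,\omega,\Delta}=\{(b_n)\in\ell^\infty(B):\lim_{n\to\omega}\sup_{\tau\in\Delta}\tau(|b_n|^2)=0\}$. $\ell^\infty(D)/J_{2,\omega,\mathrm{T}(A)|_D}$ is regarded as a subalgebra of $\ell^\infty(A)/J_{2,\omega,\mathrm{T}(A)}$, $A$ is embedded as classes of constant sequences, and $A'$ denotes the commutant of $A$ there. $\mathrm{T}(A)_\omega$ is the set of traces on $\ell^\infty(A)$ of the form $\tau((a_i))=\lim_{i\to\omega}\tau_i(a_i)$ with $\tau_i\in\mathrm{T}(A)$ (regarded as traces on the quotient). A partition of unity means mutually orthogonal projections with sum $1$. *)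

theory Defs
  imports "HOL-Analysis.Analysis"
begin

class cstar_algebra = real_normed_algebra_1 + banach +
  fixes cscale :: "complex \<Rightarrow> 'a \<Rightarrow> 'a"
    and adj :: "'a \<Rightarrow> 'a"
  assumes cscale_add_left: "cscale (a + b) x = cscale a x + cscale b x"
    and cscale_add_right: "cscale a (x + y) = cscale a x + cscale a y"
    and cscale_cscale: "cscale a (cscale b x) = cscale (a * b) x"
    and cscale_of_real: "cscale (complex_of_real r) x = scaleR r x"
    and cscale_mult_left: "cscale a (x * y) = cscale a x * y"
    and cscale_mult_right: "cscale a (x * y) = x * cscale a y"
    and norm_cscale: "norm (cscale a x) = cmod a * norm x"
    and adj_adj: "adj (adj x) = x"
    and adj_add: "adj (x + y) = adj x + adj y"
    and adj_cscale: "adj (cscale a x) = cscale (cnj a) (adj x)"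
    and adj_mult: "adj (x * y) = adj y * adj x"
    and cstar_identity: "norm (adj x * x) = (norm x)\<^sup>2"

definition unital_comm_subalgebra :: "'a::cstar_algebra set \<Rightarrow> bool" where
  "unital_comm_subalgebra D \<longleftrightarrow>
     1 \<in> D \<and> (\<forall>x\<in>D. \<forall>y\<in>D. x + y \<in> D \<and> x * y \<in> D) \<and>
     (\<forall>c. \<forall>x\<in>D. cscale c x \<in> D) \<and> (\<forall>x\<in>D. adj x \<in> D) \<and> closed D \<and>
     (\<forall>x\<in>D. \<forall>y\<in>D. x * y = y * x)"

definition positive_trace :: "('a::cstar_algebra \<Rightarrow> complex) \<Rightarrow> bool" where
  "positive_trace \<phi> \<longleftrightarrow>
     (\<forall>x y. \<phi> (x + y) = \<phi> x + \<phi> y) \<and> (\<forall>c x. \<phi> (cscale c x) = c * \<phi> x) \<and>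
     (\<forall>x. Im (\<phi> (adj x * x)) = 0 \<and> 0 \<le> Re (\<phi> (adj x * x))) \<and>
     (\<forall>x y. \<phi> (x * y) = \<phi> (y * x))"

definition tracial_state :: "('a::cstar_algebra \<Rightarrow> complex) \<Rightarrow> bool" where
  "tracial_state \<tau> \<longleftrightarrow> positive_trace \<tau> \<and> \<tau> 1 = 1"

text \<open>T(A), as a subset of the function space with the topology of pointwise
  convergence (= weak* topology).\<close>

definition tracial_states :: "('a::cstar_algebra \<Rightarrow> complex) set" where
  "tracial_states = {\<tau>. tracial_state \<tau>}"

definition convex_fset :: "('a \<Rightarrow> complex) set \<Rightarrow> bool" where
  "convex_fset K \<longleftrightarrow> (\<forall>f\<in>K. \<forall>g\<in>K. \<forall>t::real. 0 \<le> t \<and> t \<le> 1 \<longrightarrow>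
      (\<lambda>x. of_real t * f x + of_real (1 - t) * g x) \<in> K)"

definition extreme_points_fset :: "('a \<Rightarrow> complex) set \<Rightarrow> ('a \<Rightarrow> complex) set" where
  "extreme_points_fset K = {f\<in>K. \<forall>g\<in>K. \<forall>h\<in>K. \<forall>t::real. 0 < t \<and> t < 1 \<and>
      f = (\<lambda>x. of_real t * g x + of_real (1 - t) * h x) \<longrightarrow> g = f \<and> h = f}"

definition gen_cone :: "('a \<Rightarrow> complex) set \<Rightarrow> ('a \<Rightarrow> complex) set" where
  "gen_cone K = {(\<lambda>x. of_real c * k x) | c k. 0 \<le> c \<and> k \<in> K}"

definition cone_le :: "('a \<Rightarrow> complex) set \<Rightarrow> ('a \<Rightarrow> complex) \<Rightarrow> ('a \<Rightarrow> complex) \<Rightarrow> bool" where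
  "cone_le K f g \<longleftrightarrow> (\<lambda>x. g x - f x) \<in> gen_cone K"

text \<open>Choquet simplex (Choquet--Meyer): a compact convex set K (here not containing 0
  and lying in the affine hyperplane of functionals normalised at the unit) whose
  generated cone is a lattice in its own order.\<close>

definition choquet_simplex :: "('a \<Rightarrow> complex) set \<Rightarrow> bool" where
  "choquet_simplex K \<longleftrightarrow> compact K \<and> convex_fset K \<and>
     (\<forall>f\<in>gen_cone K. \<forall>g\<in>gen_cone K.
        (\<exists>s\<in>gen_cone K. cone_le K f s \<and> cone_le K g s \<and>
           (\<forall>u\<in>gen_cone K. cone_le K f u \<and> cone_le K g u \<longrightarrow> cone_le K s u)) \<and>
        (\<exists>i\<in>gen_cone K. cone_le K i f \<and> cone_le K i g \<and>
           (\<forall>l\<in>gen_cone K. cone_le K l f \<and> cone_le K l g \<longrightarrow> cone_le K l i)))"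

definition bauer_simplex :: "('a \<Rightarrow> complex) set \<Rightarrow> bool" where
  "bauer_simplex K \<longleftrightarrow> choquet_simplex K \<and> closed (extreme_points_fset K)"

definition free_ultrafilter :: "nat filter \<Rightarrow> bool" where
  "free_ultrafilter \<omega> \<longleftrightarrow> \<omega> \<noteq> bot \<and>
     (\<forall>P. eventually P \<omega> \<or> eventually (\<lambda>n. \<not> P n) \<omega>) \<and>
     (\<forall>m. eventually (\<lambda>n. n \<noteq> m) \<omega>)"

definition J2 :: "nat filter \<Rightarrow> ('a::cstar_algebra \<Rightarrow> complex) set \<Rightarrow> (nat \<Rightarrow> 'a) set" where
  "J2 \<omega> \<Delta> = {b. bounded (range b) \<and>
      ((\<lambda>n. SUP \<tau>\<in>\<Delta>. Re (\<tau> (adj (b n) * b n))) \<longlongrightarrow> 0) \<omega>}"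

text \<open>Equality in the quotient l^infty(A) / J_{2,omega,T(A)} of two bounded sequences.\<close>

definition eqJ :: "nat filter \<Rightarrow> (nat \<Rightarrow> 'a::cstar_algebra) \<Rightarrow> (nat \<Rightarrow> 'a) \<Rightarrow> bool" where
  "eqJ \<omega> x y \<longleftrightarrow> (\<lambda>n. x n - y n) \<in> J2 \<omega> tracial_states"

definition limit_trace :: "nat filter \<Rightarrow> (nat \<Rightarrow> 'a::cstar_algebra \<Rightarrow> complex) \<Rightarrow> (nat \<Rightarrow> 'a) \<Rightarrow> complex" where
  "limit_trace \<omega> \<sigma> x = Lim \<omega> (\<lambda>i. \<sigma> i (x i))"

end

theory Submission
  imports Defs
begin

text \<open>
  Fix one of the projections, represented by a sequence \<open>b\<close>. Along a sequence \<open>\<sigma>\<close> of extreme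
  tracial states, the limit \<open>\<tau>\<close> of \<open>\<sigma>\<close> on \<open>A\<close> is again extreme, as the extreme boundary is closed.
  Since \<open>b\<close> is asymptotically a central projection, \<open>a \<mapsto> lim \<sigma> k (b k * a * b k)\<close> is a positive
  trace, and so is its difference to \<open>\<tau>\<close>, which is the same expression for \<open>1 - b\<close>. By
  extremality it is a multiple of \<open>\<tau>\<close>, and the factor is its value at \<open>1\<close>, namely \<open>1/n\<close>.
  For arbitrary \<open>\<sigma>\<close>, Bauer's maximum principle dominates, for each \<open>k\<close>, the real part of any
  multiple of \<open>\<sigma> k\<close> at \<open>b k * a * b k - a/n\<close> by its value at an extreme tracial state.
\<close>

section \<open>Involution, norm and scalar multiplication; self-adjoint square roots\<close>

lemma cscale_diff_right: "cscale c (x - y) = cscale c x - cscale c (y::'a::cstar_algebra)"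
  using cscale_add_right[of c "x - y" y] by simp

lemma cscale_minus_1: "cscale (-1) (x::'a::cstar_algebra) = - x"
  using cscale_of_real[of "-1" x] by simp

lemma adj_0 [simp]: "adj (0::'a::cstar_algebra) = 0"
  using adj_add[of "0::'a" 0] by simp

lemma adj_minus: "adj (- x) = - adj (x::'a::cstar_algebra)"
  using adj_add[of x "-x"] by (metis adj_0 add.right_inverse add_eq_0_iff)

lemma adj_diff: "adj (x - y) = adj x - adj (y::'a::cstar_algebra)"
  using adj_add[of x "-y"] by (simp add: adj_minus)

lemma adj_scaleR: "adj (r *\<^sub>R x) = r *\<^sub>R adj (x::'a::cstar_algebra)"
  using adj_cscale[of "complex_of_real r" x] by (simp add: cscale_of_real)

lemma adj_1 [simp]: "adj (1::'a::cstar_algebra) = 1"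
  by (metis adj_adj adj_mult mult_1 mult_1_right)

text \<open>The C*-identity and submultiplicativity give one inequality; applied to
  \<open>adj x\<close> it gives the other.\<close>

lemma norm_adj [simp]: "norm (adj x) = norm (x::'a::cstar_algebra)"
proof -
  have le: "norm x \<le> norm (adj x)" for x :: 'a
  proof (cases "x = 0")
    case False
    have "norm x * norm x = norm (adj x * x)"
      by (simp add: cstar_identity power2_eq_square)
    also have "\<dots> \<le> norm (adj x) * norm x" by (rule norm_mult_ineq)
    finally show ?thesis using False by simp
  qed simp
  show ?thesis using le[of x] le[of "adj x"] by (simp add: adj_adj)
qed

lemma bounded_linear_adj: "bounded_linear (adj :: 'a::cstar_algebra \<Rightarrow> 'a)"
  by (rule bounded_linear_intro[where K=1]) (auto simp: adj_add adj_scaleR)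

lemma adj_power: "adj (x ^ n) = adj (x::'a::cstar_algebra) ^ n"
  by (induction n) (auto simp: adj_mult power_commutes)

text \<open>The root is the binomial series of \<open>(1 - z) powr (1/2)\<close> at \<open>z = h\<close>;
  squaring it is Vandermonde's identity.\<close>

lemma selfadjoint_sqrt:
  fixes h :: "'a::cstar_algebra"
  assumes "adj h = h" "norm h < 1"
  obtains s where "adj s = s" "s * s = 1 - h"
proof -
  define c :: "nat \<Rightarrow> real" where "c j = ((1/2) gchoose j) * (-1) ^ j" for j
  define a where "a j = c j *\<^sub>R h ^ j" for j
  \<comment> \<open>A point strictly between \<open>norm h\<close> and 1: convergence of the
    binomial series at \<open>- r\<close> makes it absolutely convergent at
    \<open>norm h\<close>.\<close>
  obtain r where r: "norm h < r" "r < 1" using assms(2) dense by blast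
  have rpos: "0 < r" using r(1) norm_ge_zero[of h] by linarith
  have "summable (\<lambda>j. ((1/2) gchoose j) * (- r) ^ j)"
    using gen_binomial_real[of "-r" "1/2"] r rpos by (auto simp: sums_iff)
  from powser_insidea[OF this, of "norm h"] r rpos
  have "summable (\<lambda>j. norm (((1/2) gchoose j) * norm h ^ j))" by simp
  then have sa: "summable (\<lambda>j. norm (a j))"
  proof (rule summable_comparison_test[rotated], intro exI allI impI)
    fix j
    show "norm (norm (a j)) \<le> norm (((1/2) gchoose j) * norm h ^ j)"
      unfolding a_def c_def
      by (simp add: abs_mult power_abs mult_left_mono norm_power_ineq)
  qed
  have conv: "(\<Sum>i\<le>k. a i * a (k - i)) = ((1 gchoose k) * (-1) ^ k) *\<^sub>R h ^ k" for k
  proof -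
    have "(\<Sum>i\<le>k. a i * a (k - i)) = (\<Sum>i\<le>k. (c i * c (k - i)) *\<^sub>R h ^ k)"
      by (rule sum.cong) (auto simp: a_def mult.commute simp flip: power_add)
    also have "\<dots> = (\<Sum>i\<le>k. (((1/2) gchoose i) * ((1/2) gchoose (k - i)) * (-1) ^ k) *\<^sub>R h ^ k)"
    proof (rule sum.cong)
      fix i assume "i \<in> {..k}"
      then have "(-1::real) ^ i * (-1) ^ (k - i) = (-1) ^ k" by (simp flip: power_add)
      moreover have "c i * c (k - i) =
          ((1/2) gchoose i) * ((1/2) gchoose (k - i)) * ((-1) ^ i * (-1) ^ (k - i))"
        unfolding c_def by (simp only: mult_ac)
      ultimately show "(c i * c (k - i)) *\<^sub>R h ^ k =
          (((1/2) gchoose i) * ((1/2) gchoose (k - i)) * (-1) ^ k) *\<^sub>R h ^ k"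
        by (simp only:)
    qed simp
    also have "\<dots> = ((\<Sum>i\<le>k. ((1/2) gchoose i) * ((1/2) gchoose (k - i))) * (-1) ^ k) *\<^sub>R h ^ k"
      by (simp add: sum_distrib_right scaleR_sum_left)
    also have "(\<Sum>i\<le>k. ((1/2::real) gchoose i) * ((1/2) gchoose (k - i))) = (1 gchoose k)"
      using gbinomial_Vandermonde[of "1/2::real" "1/2" k] by (simp add: atMost_atLeast0)
    finally show ?thesis .
  qed
  \<comment> \<open>\<open>1 gchoose k\<close> is an ordinary binomial coefficient, so the squared
    series stops after \<open>1 - h\<close>.\<close>
  have fin: "((1 gchoose k) * (-1) ^ k) *\<^sub>R h ^ k = 0" if "k \<notin> {0, 1}" for k
  proof -
    have "(1::real) gchoose k = of_nat (1 choose k)"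
      using binomial_gbinomial[of 1 k, where ?'a = real] by simp
    then show ?thesis using that by (auto simp: binomial_eq_0_iff)
  qed
  have "suminf a * suminf a = (\<Sum>k. ((1 gchoose k) * (-1) ^ k) *\<^sub>R h ^ k)"
    using Cauchy_product[OF sa sa] by (simp add: conv)
  also have "\<dots> = (\<Sum>k\<in>{0, 1}. ((1 gchoose k) * (-1) ^ k) *\<^sub>R h ^ k)"
    by (rule suminf_finite) (use fin in auto)
  also have "\<dots> = 1 - h" by simp
  finally have sq: "suminf a * suminf a = 1 - h" .
  have "adj (suminf a) = (\<Sum>j. adj (a j))"
    by (rule bounded_linear.suminf[OF bounded_linear_adj summable_norm_cancel[OF sa]])
  also have "(\<lambda>j. adj (a j)) = a" by (rule ext) (simp add: a_def adj_scaleR adj_power assms(1))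
  finally show ?thesis using sq that by blast
qed

section \<open>Positive functionals: Cauchy-Schwarz and the norm bound\<close>

definition positive_functional :: "('a::cstar_algebra \<Rightarrow> complex) \<Rightarrow> bool" where
  "positive_functional \<phi> \<longleftrightarrow>
     (\<forall>x y. \<phi> (x + y) = \<phi> x + \<phi> y) \<and> (\<forall>c x. \<phi> (cscale c x) = c * \<phi> x) \<and>
     (\<forall>x. Im (\<phi> (adj x * x)) = 0 \<and> 0 \<le> Re (\<phi> (adj x * x)))"

lemma positive_trace_imp_positive_functional: "positive_trace \<phi> \<Longrightarrow> positive_functional \<phi>"
  unfolding positive_trace_def positive_functional_def by blast

context
  fixes \<phi> :: "'a::cstar_algebra \<Rightarrow> complex"
  assumes pos: "positive_functional \<phi>"
begin

lemma functional_add: "\<phi> (x + y) = \<phi> x + \<phi> y"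
  and functional_cscale: "\<phi> (cscale c x) = c * \<phi> x"
  and functional_Im: "Im (\<phi> (adj x * x)) = 0"
  and functional_nonneg: "0 \<le> Re (\<phi> (adj x * x))"
  using pos by (auto simp: positive_functional_def)

lemma functional_minus: "\<phi> (- x) = - \<phi> x"
  using functional_cscale[of "-1" x] by (simp add: cscale_minus_1)

lemma functional_diff: "\<phi> (x - y) = \<phi> x - \<phi> y"
  using functional_add[of x "-y"] by (simp add: functional_minus)

lemma functional_square_diff:
  "\<phi> (adj (x - cscale l y) * (x - cscale l y)) =
    \<phi> (adj x * x) - l * \<phi> (adj x * y) - cnj l * \<phi> (adj y * x) + cnj l * l * \<phi> (adj y * y)"
proof -
  have "adj (x - cscale l y) * (x - cscale l y) =
      adj x * x - cscale l (adj x * y) - cscale (cnj l) (adj y * x)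
        + cscale (cnj l * l) (adj y * y)"
    by (simp add: adj_diff adj_cscale left_diff_distrib right_diff_distrib cscale_cscale cscale_diff_right
        mult.commute[of l]
        flip: cscale_mult_left cscale_mult_right)
  then show ?thesis
    by (simp only: functional_diff functional_add functional_cscale)
qed

text \<open>Polarization: values on \<open>adj z * z\<close> are real, and \<open>z = x - y\<close>
  and \<open>z = x - \<i> y\<close> compare the imaginary and the real parts.\<close>

lemma functional_hermitian: "\<phi> (adj y * x) = cnj (\<phi> (adj x * y))"
proof -
  have "Im (\<phi> (adj x * y)) + Im (\<phi> (adj y * x)) = 0"
    using functional_Im[of "x - cscale 1 y"] unfolding functional_square_diff
    by (simp add: functional_Im)
  moreover have "Re (\<phi> (adj x * y)) - Re (\<phi> (adj y * x)) = 0"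
    using functional_Im[of "x - cscale \<i> y"] unfolding functional_square_diff
    by (simp add: functional_Im)
  ultimately show ?thesis by (simp add: complex_eq_iff)
qed

text \<open>Positivity on \<open>x - l y\<close> for suitable scalars \<open>l\<close> gives a
  quadratic inequality in a real parameter \<open>r\<close>, which is then optimized.\<close>

lemma functional_Cauchy_Schwarz:
  "(cmod (\<phi> (adj x * y)))\<^sup>2 \<le> Re (\<phi> (adj x * x)) * Re (\<phi> (adj y * y))"
proof -
  define w X Y where "w = \<phi> (adj x * y)" and "X = Re (\<phi> (adj x * x))" and "Y = Re (\<phi> (adj y * y))"
  have Y0: "0 \<le> Y" and X0: "0 \<le> X" using functional_nonneg by (auto simp: X_def Y_def)
  \<comment> \<open>The phase \<open>cnj w\<close> in the scalar makes both cross terms equal to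
    \<open>r * (cmod w)\<^sup>2\<close>.\<close>
  have key: "2 * r * (cmod w)\<^sup>2 \<le> X + r\<^sup>2 * (cmod w)\<^sup>2 * Y" for r :: real
  proof -
    have "0 \<le> Re (\<phi> (adj (x - cscale (of_real r * cnj w) y) * (x - cscale (of_real r * cnj w) y)))"
      by (rule functional_nonneg)
    also have "\<dots> = X - 2 * r * (cmod w)\<^sup>2 + r\<^sup>2 * (cmod w)\<^sup>2 * Y"
      unfolding functional_square_diff functional_hermitian[of y x] cmod_power2
      by (simp add: w_def[symmetric] X_def Y_def functional_Im power2_eq_square algebra_simps)
    finally show ?thesis by simp
  qed
  show ?thesis
  proof (cases "Y = 0")
    case True
    have "w = 0"
    proof (rule ccontr)
      assume "w \<noteq> 0"
      \<comment> \<open>With \<open>Y = 0\<close> the bound is linear in \<open>r\<close>, and this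
        \<open>r\<close> would give \<open>2 * (X + 1) \<le> X\<close>.\<close>
      then show False using key[of "(X + 1) / (cmod w)\<^sup>2"] True X0 by simp
    qed
    then show ?thesis using X0 Y0 by (simp flip: w_def X_def Y_def)
  next
    case False
    then have "(cmod w)\<^sup>2 / Y \<le> X"
      using key[of "1 / Y"] by (simp add: power2_eq_square)
    then show ?thesis using False Y0 by (simp add: field_simps flip: w_def X_def Y_def)
  qed
qed

text \<open>If \<open>C\<close> exceeds \<open>(norm x)\<^sup>2\<close> and
  \<open>h = adj x * x / C\<close>, then \<open>1 - h\<close> is the square of a self-adjoint
  element, so \<open>\<phi>\<close> is nonnegative on it. Letting \<open>C\<close> decrease gives
  the bound.\<close>

lemma functional_square_le: "Re (\<phi> (adj x * x)) \<le> (norm x)\<^sup>2 * Re (\<phi> 1)"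
proof -
  have 1: "0 \<le> Re (\<phi> 1)" using functional_nonneg[of 1] by simp
  have "Re (\<phi> (adj x * x)) \<le> C * Re (\<phi> 1)" if C: "(norm x)\<^sup>2 < C" for C
  proof -
    have Cpos: "0 < C" using C by (rule le_less_trans[rotated]) simp
    define h where "h = (1 / C) *\<^sub>R (adj x * x)"
    have "adj h = h" by (simp add: h_def adj_scaleR adj_mult adj_adj)
    moreover have "norm h < 1" using C Cpos by (simp add: h_def cstar_identity)
    ultimately obtain s where s: "adj s = s" "s * s = 1 - h" by (rule selfadjoint_sqrt)
    have "0 \<le> Re (\<phi> (adj s * s))" by (rule functional_nonneg)
    also have "\<dots> = Re (\<phi> 1) - Re (\<phi> (adj x * x)) / C"
      using functional_cscale[of "complex_of_real (1 / C)" "adj x * x"]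
      unfolding cscale_of_real by (simp add: s functional_diff h_def)
    finally show ?thesis using Cpos by (simp add: field_simps)
  qed
  note bound = this
  show ?thesis
  proof (rule field_le_epsilon)
    fix e :: real assume e: "e > 0"
    \<comment> \<open>The added 1 keeps the denominator positive when \<open>\<phi> 1\<close>
      vanishes.\<close>
    have "Re (\<phi> (adj x * x)) \<le> ((norm x)\<^sup>2 + e / (Re (\<phi> 1) + 1)) * Re (\<phi> 1)"
      by (rule bound) (use e 1 in simp)
    also have "\<dots> = (norm x)\<^sup>2 * Re (\<phi> 1) + e * (Re (\<phi> 1) / (Re (\<phi> 1) + 1))"
      by (simp add: algebra_simps)
    also have "\<dots> \<le> (norm x)\<^sup>2 * Re (\<phi> 1) + e * 1"
      using e 1 by (intro add_left_mono mult_left_mono) auto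
    finally show "Re (\<phi> (adj x * x)) \<le> (norm x)\<^sup>2 * Re (\<phi> 1) + e" by simp
  qed
qed

end

section \<open>Pointwise topology, closed faces and Bauer's maximum principle\<close>

text \<open>The topology of a function space is the product topology. This turns ultralimits taken
  at each element into a limit of traces, to which closedness of the extreme boundary
  applies.\<close>

lemma tendsto_fun:
  fixes \<sigma> :: "'c \<Rightarrow> 'a \<Rightarrow> complex"
  assumes "\<And>x. ((\<lambda>k. \<sigma> k x) \<longlongrightarrow> \<tau> x) F"
  shows "(\<sigma> \<longlongrightarrow> \<tau>) F"
  using assms limitin_componentwise[of "\<lambda>_. euclidean" UNIV \<sigma> \<tau> F]
  by (simp add: euclidean_product_topology)

text \<open>A product of copies of the complex plane is Hausdorff, and compact sets in Hausdorff
  spaces are closed.\<close>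

lemma compact_imp_closed_fun:
  fixes K :: "('a \<Rightarrow> complex) set"
  assumes "compact K"
  shows "closed K"
proof -
  have "Hausdorff_space (product_topology (\<lambda>_::'a. euclidean :: complex topology) UNIV)"
    by (simp add: Hausdorff_space_product_topology)
  then have "Hausdorff_space (euclidean :: ('a \<Rightarrow> complex) topology)"
    by (simp only: euclidean_product_topology)
  then show ?thesis
    using compactin_imp_closedin assms by (metis closed_closedin compactin_euclidean_iff)
qed

text \<open>The extremal sets of the Krein-Milman theorem, without convexity. Nonemptiness is built
  in so that a minimal one still has a point.\<close>

definition closed_face :: "('a \<Rightarrow> complex) set \<Rightarrow> ('a \<Rightarrow> complex) set \<Rightarrow> bool" where
  "closed_face K F \<longleftrightarrow> closed F \<and> F \<subseteq> K \<and> F \<noteq> {} \<and>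
     (\<forall>g\<in>K. \<forall>h\<in>K. \<forall>t::real. 0 < t \<and> t < 1 \<and>
       (\<lambda>x. of_real t * g x + of_real (1 - t) * h x) \<in> F \<longrightarrow> g \<in> F \<and> h \<in> F)"

text \<open>Compactness of \<open>F\<close> gives a maximizer. If a proper convex combination
  attains the maximum, so do both ends, since neither exceeds it. The factor \<open>c\<close> allows
  every real-linear functional of the complex coordinate at \<open>x\<close>.\<close>

lemma closed_face_maximizers:
  assumes K: "compact K" and F: "closed_face K F"
  shows "closed_face K {f\<in>F. \<forall>g\<in>F. Re (c * g x) \<le> Re (c * f x)}" (is "closed_face K ?M")
  unfolding closed_face_def
proof (intro conjI ballI allI impI)
  have clF: "closed F" and FK: "F \<subseteq> K" and neF: "F \<noteq> {}"
    and face: "\<And>g h t. g \<in> K \<Longrightarrow> h \<in> K \<Longrightarrow> 0 < t \<Longrightarrow> t < 1 \<Longrightarrow>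
       (\<lambda>x. of_real t * g x + of_real (1 - t) * h x) \<in> F \<Longrightarrow> g \<in> F \<and> h \<in> F"
    using F unfolding closed_face_def by blast+
  have cont: "continuous_on UNIV (\<lambda>f. Re (c * f x))"
    by (intro continuous_intros continuous_on_product_coordinates)
  have "?M = F \<inter> (\<Inter>g\<in>F. {f. Re (c * g x) \<le> Re (c * f x)})" by auto
  then show "closed ?M"
    using clF by (simp only:)
      (intro closed_Int closed_INT ballI closed_Collect_le continuous_on_const cont)
  show "?M \<subseteq> K" using FK by blast
  have "compact F" using compact_Int_closed[OF K clF] FK by (simp add: Int_absorb1)
  from continuous_attains_sup[OF this neF continuous_on_subset[OF cont]]
  show "?M \<noteq> {}" by auto
  fix g h and t :: real
  assume g: "g \<in> K" and h: "h \<in> K"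
    and t: "0 < t \<and> t < 1 \<and> (\<lambda>x. of_real t * g x + of_real (1 - t) * h x) \<in> ?M"
  define w where "w = (\<lambda>x. of_real t * g x + of_real (1 - t) * h x)"
  have gh: "g \<in> F" "h \<in> F" using face[OF g h, of t] t by auto
  have max: "Re (c * f x) \<le> Re (c * w x)" if "f \<in> F" for f
    using t that by (simp add: w_def)
  have "Re (c * w x) = t * Re (c * g x) + (1 - t) * Re (c * h x)"
    by (simp add: w_def algebra_simps)
  then have "t * (Re (c * w x) - Re (c * g x)) + (1 - t) * (Re (c * w x) - Re (c * h x)) = 0"
    by (simp add: algebra_simps)
  moreover have "0 \<le> t * (Re (c * w x) - Re (c * g x))" "0 \<le> (1 - t) * (Re (c * w x) - Re (c * h x))"
    using t max gh by auto
  ultimately have "t * (Re (c * w x) - Re (c * g x)) = 0" "(1 - t) * (Re (c * w x) - Re (c * h x)) = 0"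
    by linarith+
  then have "Re (c * g x) = Re (c * w x)" "Re (c * h x) = Re (c * w x)"
    using t by auto
  then show "g \<in> ?M" "h \<in> ?M" using gh max by simp_all
qed

text \<open>Lower bounds for Zorn's lemma: finitely many members of a chain have a smallest one,
  which is nonempty, so compactness makes the whole intersection nonempty.\<close>

lemma closed_face_Inter:
  assumes K: "compact K" and ne: "C \<noteq> {}" and C: "\<And>F. F \<in> C \<Longrightarrow> closed_face K F"
    and chain: "\<And>F G. F \<in> C \<Longrightarrow> G \<in> C \<Longrightarrow> F \<subseteq> G \<or> G \<subseteq> F"
  shows "closed_face K (\<Inter>C)"
  unfolding closed_face_def
proof (intro conjI ballI allI impI)
  show "closed (\<Inter>C)" using C by (auto simp: closed_face_def)
  show "\<Inter>C \<subseteq> K" using C ne unfolding closed_face_def by blast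
  have "K \<inter> \<Inter>C \<noteq> {}"
  proof (rule compact_imp_fip[OF K])
    show "closed T" if "T \<in> C" for T using C that by (auto simp: closed_face_def)
    fix C' assume C': "finite C'" "C' \<subseteq> C"
    have "\<exists>F\<in>C. F \<subseteq> \<Inter>C'" using C'
    proof (induction C' rule: finite_induct)
      case empty
      then show ?case using ne by auto
    next
      case (insert G C')
      then obtain F where "F \<in> C" "F \<subseteq> \<Inter>C'" by auto
      then show ?case using chain[of F G] insert.prems by (metis Inter_insert insert_subset le_inf_iff order.refl order_trans)
    qed
    then obtain F where "F \<in> C" "F \<subseteq> \<Inter>C'" by blast
    moreover have "F \<noteq> {}" "F \<subseteq> K" using C[OF \<open>F \<in> C\<close>] by (auto simp: closed_face_def)
    ultimately show "K \<inter> \<Inter>C' \<noteq> {}" by blast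
  qed
  then show "\<Inter>C \<noteq> {}" by blast
  fix g h and t :: real
  assume "g \<in> K" "h \<in> K" "0 < t \<and> t < 1 \<and> (\<lambda>x. of_real t * g x + of_real (1 - t) * h x) \<in> \<Inter>C"
  then have "g \<in> F \<and> h \<in> F" if "F \<in> C" for F using C[OF that] that unfolding closed_face_def by blast
  then show "g \<in> \<Inter>C" "h \<in> \<Inter>C" by auto
qed

text \<open>A minimal closed face is a singleton, as otherwise a coordinate functional separating two of
  its points would be maximal on a smaller one.\<close>

lemma closed_face_contains_extreme_point:
  assumes K: "compact K" and F: "closed_face K F"
  obtains e where "e \<in> F" "e \<in> extreme_points_fset K"
proof -
  \<comment> \<open>Faces enter through their complements, since the form of Zorn's lemma used here
    yields maximal sets: a maximal \<open>M\<close> has a minimal face as its complement.\<close>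
  define A where "A = {U. closed_face K (- U) \<and> - U \<subseteq> F}"
  have "\<exists>M\<in>A. \<forall>X\<in>A. M \<subseteq> X \<longrightarrow> X = M"
  proof (rule subset_Zorn_nonempty)
    show "A \<noteq> {}" using F unfolding A_def by (auto intro!: exI[of _ "- F"])
    fix C assume ne: "C \<noteq> {}" and C: "subset.chain A C"
    have "C \<subseteq> A" and chain: "\<And>U V. U \<in> C \<Longrightarrow> V \<in> C \<Longrightarrow> U \<subseteq> V \<or> V \<subseteq> U"
      using C unfolding subset_chain_def by blast+
    have "closed_face K (\<Inter>(uminus ` C))"
    proof (rule closed_face_Inter[OF K])
      show "closed_face K G" if "G \<in> uminus ` C" for G
        using that \<open>C \<subseteq> A\<close> by (auto simp: A_def)
      fix G H assume "G \<in> uminus ` C" "H \<in> uminus ` C"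
      then obtain U V where "G = - U" "H = - V" "U \<in> C" "V \<in> C" by blast
      then show "G \<subseteq> H \<or> H \<subseteq> G" using chain[of U V] by simp blast
    qed (use ne in simp)
    then show "\<Union>C \<in> A" using ne \<open>C \<subseteq> A\<close> by (auto simp: A_def uminus_Sup)
  qed
  then obtain M where MA: "M \<in> A" and min: "\<And>X. X \<in> A \<Longrightarrow> M \<subseteq> X \<Longrightarrow> X = M"
    by blast
  have M: "closed_face K (- M)" "- M \<subseteq> F" using MA by (auto simp: A_def)
  have min': "G = - M" if "closed_face K G" "G \<subseteq> - M" for G
    using min[of "- G"] that M(2) by (auto simp: A_def)
  obtain e where e: "e \<in> - M" using M(1) by (auto simp: closed_face_def)
  have single: "f = e" if f: "f \<in> - M" for f
  proof (rule ccontr)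
    assume "f \<noteq> e"
    then obtain x where x: "f x \<noteq> e x" by auto
    \<comment> \<open>This \<open>c\<close> makes \<open>Re (c * (f x - e x))\<close> the squared
      modulus of \<open>f x - e x\<close>, while minimality of \<open>- M\<close> makes
      \<open>e\<close> a maximizer too.\<close>
    define c where "c = cnj (f x - e x)"
    have "{f \<in> - M. \<forall>g\<in>- M. Re (c * g x) \<le> Re (c * f x)} = - M"
      by (rule min'[OF closed_face_maximizers[OF K M(1)]]) auto
    then have "Re (c * f x) \<le> Re (c * e x)" using e f by blast
    then have "Re (c * (f x - e x)) \<le> 0" by (simp add: right_diff_distrib)
    moreover have "Re (c * (f x - e x)) = (cmod (f x - e x))\<^sup>2"
      unfolding c_def cmod_power2 by (simp add: power2_eq_square algebra_simps)
    ultimately have "(cmod (f x - e x))\<^sup>2 \<le> 0" by (simp only:)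
    then show False using x by simp
  qed
  have "e \<in> extreme_points_fset K"
    unfolding extreme_points_fset_def
  proof (intro CollectI conjI ballI allI impI)
    show "e \<in> K" using M(1) e by (auto simp: closed_face_def)
    fix g h and t :: real
    assume "g \<in> K" "h \<in> K" and t: "0 < t \<and> t < 1 \<and> e = (\<lambda>x. of_real t * g x + of_real (1 - t) * h x)"
    then have "g \<in> - M" "h \<in> - M" using M(1) e unfolding closed_face_def by blast+
    then show "g = e" "h = e" using single by blast+
  qed
  then show ?thesis using that e M(2) by blast
qed

text \<open>The maximizers of the functional over \<open>K\<close> form a closed face of
  \<open>K\<close>, and every closed face contains an extreme point of \<open>K\<close>.\<close>

lemma Bauer_maximum_principle:
  assumes K: "compact K" and f: "f \<in> K"
  obtains e where "e \<in> extreme_points_fset K" "Re (c * f x) \<le> Re (c * e x)"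
proof -
  have "closed_face K K"
    using f compact_imp_closed_fun[OF K] by (auto simp: closed_face_def)
  from closed_face_contains_extreme_point[OF K closed_face_maximizers[OF K this, of c x]]
  obtain e where "e \<in> extreme_points_fset K" "\<forall>g\<in>K. Re (c * g x) \<le> Re (c * e x)" by blast
  then show ?thesis using that f by blast
qed

section \<open>Norm estimates for tracial states\<close>

lemma tracial_statesD: "\<tau> \<in> tracial_states \<Longrightarrow> tracial_state \<tau>"
  by (simp add: tracial_states_def)

lemma tracial_state_positive_functional: "tracial_state \<tau> \<Longrightarrow> positive_functional \<tau>"
  by (simp add: tracial_state_def positive_trace_imp_positive_functional)

lemma positive_trace_commute: "positive_trace \<phi> \<Longrightarrow> \<phi> (x * y) = \<phi> (y * x)"
  unfolding positive_trace_def by blast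

lemma tracial_state_commute: "tracial_state \<tau> \<Longrightarrow> \<tau> (x * y) = \<tau> (y * x)"
  by (simp add: tracial_state_def positive_trace_commute)

lemma tracial_state_square_le:
  assumes "tracial_state \<tau>"
  shows "Re (\<tau> (adj x * x)) \<le> (norm x)\<^sup>2"
  using functional_square_le[OF tracial_state_positive_functional[OF assms], of x] assms
  by (simp add: tracial_state_def)

text \<open>Cauchy-Schwarz gives a bound in terms of \<open>x * adj x\<close>; the trace property
  turns this into \<open>adj x * x\<close>, the quantity in \<open>J2\<close>.\<close>

lemma tracial_state_mult_le:
  assumes "tracial_state \<tau>"
  shows "(cmod (\<tau> (x * y)))\<^sup>2 \<le> Re (\<tau> (adj x * x)) * (norm y)\<^sup>2"
proof -
  note pf = tracial_state_positive_functional[OF assms]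
  have "(cmod (\<tau> (x * y)))\<^sup>2 \<le> Re (\<tau> (x * adj x)) * Re (\<tau> (adj y * y))"
    using functional_Cauchy_Schwarz[OF pf, of "adj x" y] by (simp only: adj_adj)
  also have "\<tau> (x * adj x) = \<tau> (adj x * x)" by (rule tracial_state_commute[OF assms])
  also have "Re (\<tau> (adj x * x)) * Re (\<tau> (adj y * y)) \<le> Re (\<tau> (adj x * x)) * (norm y)\<^sup>2"
    by (intro mult_left_mono tracial_state_square_le[OF assms] functional_nonneg[OF pf])
  finally show ?thesis .
qed

lemma tracial_state_le_norm:
  assumes "tracial_state \<tau>"
  shows "cmod (\<tau> x) \<le> norm x"
  using tracial_state_mult_le[OF assms, of 1 x] assms
  by (simp add: tracial_state_def power2_le_iff_abs_le)

section \<open>Ultrafilter limits and bounded sequences\<close>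

lemma ultrafilter_neq_bot: "free_ultrafilter \<omega> \<Longrightarrow> \<omega> \<noteq> bot"
  unfolding free_ultrafilter_def by blast

text \<open>Compactness gives a cluster point of the image filter. An ultrafilter decides whether
  \<open>f k\<close> lies in a given neighbourhood, and a cluster point excludes the negative
  answer.\<close>

lemma ultrafilter_bounded_convergent:
  fixes f :: "nat \<Rightarrow> complex"
  assumes \<omega>: "free_ultrafilter \<omega>" and f: "bounded (range f)"
  obtains l where "(f \<longlongrightarrow> l) \<omega>"
proof -
  have "compact (closure (range f))" using f by simp
  moreover have "filtermap f \<omega> \<noteq> bot"
    using \<omega> unfolding free_ultrafilter_def filtermap_bot_iff by blast
  moreover have "eventually (\<lambda>x. x \<in> closure (range f)) (filtermap f \<omega>)"
    unfolding eventually_filtermap by (intro always_eventually allI subsetD[OF closure_subset] rangeI)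
  ultimately obtain l where l: "inf (nhds l) (filtermap f \<omega>) \<noteq> bot"
    unfolding compact_filter by blast
  have "(f \<longlongrightarrow> l) \<omega>"
  proof (rule topological_tendstoI)
    fix S assume S: "open S" "l \<in> S"
    have "\<not> eventually (\<lambda>k. f k \<notin> S) \<omega>"
    proof
      assume "eventually (\<lambda>k. f k \<notin> S) \<omega>"
      then have "eventually (\<lambda>x. x \<notin> S) (inf (nhds l) (filtermap f \<omega>))"
        by (intro filter_leD[OF inf_le2]) (simp add: eventually_filtermap)
      moreover have "eventually (\<lambda>x. x \<in> S) (inf (nhds l) (filtermap f \<omega>))"
        using S by (intro filter_leD[OF inf_le1] eventually_nhds_in_open)
      ultimately have "eventually (\<lambda>_. False) (inf (nhds l) (filtermap f \<omega>))"
        by (rule eventually_elim2) simp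
      then show False using l by (simp add: eventually_False)
    qed
    then show "eventually (\<lambda>k. f k \<in> S) \<omega>"
      using \<omega> unfolding free_ultrafilter_def by blast
  qed
  then show ?thesis by (rule that)
qed

lemma bounded_range_mult:
  fixes x y :: "nat \<Rightarrow> 'a::real_normed_algebra"
  assumes "bounded (range x)" "bounded (range y)"
  shows "bounded (range (\<lambda>k. x k * y k))"
proof -
  obtain B C where B: "\<And>k. norm (x k) \<le> B" and C: "\<And>k. norm (y k) \<le> C"
    using assms by (auto simp: bounded_iff)
  have "norm (x k * y k) \<le> B * C" for k
    by (rule order_trans[OF norm_mult_ineq mult_mono'[OF B C]]) auto
  then show ?thesis by (auto simp: bounded_iff)
qed

lemma bounded_range_const: "bounded (range (\<lambda>k::nat. c :: 'a::real_normed_vector))"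
  by (auto simp: bounded_iff)

lemma bounded_range_diff:
  fixes x y :: "nat \<Rightarrow> 'a::real_normed_vector"
  assumes "bounded (range x)" "bounded (range y)"
  shows "bounded (range (\<lambda>k. x k - y k))"
  using bounded_minus_comp[of x UNIV y] assms by simp

lemma bounded_range_adj:
  "bounded (range x) \<Longrightarrow> bounded (range (\<lambda>k::nat. adj (x k :: 'a::cstar_algebra)))"
  by (auto simp: bounded_iff)

lemmas bounded_range_intros =
  bounded_range_mult bounded_range_const bounded_range_diff bounded_range_adj

lemma J2_minus: "b \<in> J2 \<omega> \<Delta> \<Longrightarrow> (\<lambda>k. - b k) \<in> J2 \<omega> \<Delta>"
  by (auto simp: J2_def adj_minus bounded_iff)

section \<open>Limit traces and compression by an asymptotically central projection\<close>

context
  fixes \<omega> :: "nat filter" and \<sigma> :: "nat \<Rightarrow> 'a::cstar_algebra \<Rightarrow> complex"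
  assumes \<omega>: "free_ultrafilter \<omega>" and \<sigma>: "\<And>m. \<sigma> m \<in> tracial_states"
begin

lemmas tracial_state_seq = tracial_statesD[OF \<sigma>]
lemmas seq_positive = tracial_state_positive_functional[OF tracial_state_seq]
lemmas seq_commute = tracial_state_commute[OF tracial_state_seq]

lemma limit_trace_eqI: "((\<lambda>k. \<sigma> k (x k)) \<longlongrightarrow> l) \<omega> \<Longrightarrow> limit_trace \<omega> \<sigma> x = l"
  unfolding limit_trace_def by (rule tendsto_Lim[OF ultrafilter_neq_bot[OF \<omega>]])

text \<open>\<open>limit_trace\<close> is a \<open>Lim\<close> and has a meaning only once the limit
  exists; tracial states are contractive, so bounded sequences have bounded values.\<close>

lemma tendsto_limit_trace:
  assumes "bounded (range x)"
  shows "((\<lambda>k. \<sigma> k (x k)) \<longlongrightarrow> limit_trace \<omega> \<sigma> x) \<omega>"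
proof -
  obtain B where "\<And>k. norm (x k) \<le> B" using assms by (auto simp: bounded_iff)
  then have "bounded (range (\<lambda>k. \<sigma> k (x k)))"
    using tracial_state_le_norm[OF tracial_state_seq] order_trans by (auto simp: bounded_iff) blast
  then obtain l where "((\<lambda>k. \<sigma> k (x k)) \<longlongrightarrow> l) \<omega>"
    by (rule ultrafilter_bounded_convergent[OF \<omega>])
  then show ?thesis using limit_trace_eqI by metis
qed

text \<open>The way membership in \<open>J2\<close> is used: errors in the ideal disappear in the
  limit even after multiplication by a bounded sequence. The supremum over all tracial states bounds
  the value at each single \<open>\<sigma> k\<close>.\<close>

lemma tendsto_J2_mult:
  assumes b: "b \<in> J2 \<omega> tracial_states" and z: "bounded (range z)"
  shows "((\<lambda>k. \<sigma> k (b k * z k)) \<longlongrightarrow> 0) \<omega>"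
proof -
  define S where "S k = (SUP \<tau>\<in>tracial_states. Re (\<tau> (adj (b k) * b k)))" for k
  have S: "(S \<longlongrightarrow> 0) \<omega>" using b by (simp add: J2_def S_def[abs_def])
  obtain C where C: "\<And>k. norm (z k) \<le> C" using z by (auto simp: bounded_iff)
  have S_ge: "Re (\<sigma> k (adj (b k) * b k)) \<le> S k" for k
    unfolding S_def
  proof (rule cSUP_upper[OF \<sigma>])
    \<comment> \<open>\<open>SUP\<close> over the reals is an upper bound only of a set bounded
      above; the square of the norm bounds this one.\<close>
    show "bdd_above ((\<lambda>\<tau>. Re (\<tau> (adj (b k) * b k))) ` tracial_states)"
      by (rule bdd_aboveI2[where M = "(norm (b k))\<^sup>2"])
        (simp add: tracial_states_def tracial_state_square_le)
  qed
  have le: "(cmod (\<sigma> k (b k * z k)))\<^sup>2 \<le> S k * C\<^sup>2" for k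
  proof -
    have nonneg: "0 \<le> Re (\<sigma> k (adj (b k) * b k))" by (rule functional_nonneg[OF seq_positive])
    have "(norm (z k))\<^sup>2 \<le> C\<^sup>2" using C by (intro power_mono) auto
    then have "Re (\<sigma> k (adj (b k) * b k)) * (norm (z k))\<^sup>2 \<le> S k * C\<^sup>2"
      using S_ge[of k] nonneg by (intro mult_mono) auto
    then show ?thesis
      using tracial_state_mult_le[OF tracial_state_seq] by (rule order_trans[rotated])
  qed
  have "((\<lambda>k. (cmod (\<sigma> k (b k * z k)))\<^sup>2) \<longlongrightarrow> 0) \<omega>"
  proof (rule tendsto_sandwich)
    show "eventually (\<lambda>k. 0 \<le> (cmod (\<sigma> k (b k * z k)))\<^sup>2) \<omega>" by (intro always_eventually) simp
    show "eventually (\<lambda>k. (cmod (\<sigma> k (b k * z k)))\<^sup>2 \<le> S k * C\<^sup>2) \<omega>"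
      by (intro always_eventually allI le)
    show "((\<lambda>k. 0) \<longlongrightarrow> (0::real)) \<omega>" by (rule tendsto_const)
    show "((\<lambda>k. S k * C\<^sup>2) \<longlongrightarrow> 0) \<omega>" by (rule tendsto_mult_left_zero[OF S])
  qed
  then have "((\<lambda>k. cmod (\<sigma> k (b k * z k))) \<longlongrightarrow> 0) \<omega>"
    by (rule power_tendsto_0_iff[THEN iffD1, rotated]) simp
  then show ?thesis by (rule tendsto_norm_zero_cancel)
qed

lemma limit_trace_cong:
  assumes "bounded (range x)" and "((\<lambda>k. \<sigma> k (y k - x k)) \<longlongrightarrow> 0) \<omega>"
  shows "limit_trace \<omega> \<sigma> y = limit_trace \<omega> \<sigma> x"
  using tendsto_add[OF assms(2) tendsto_limit_trace[OF assms(1)]]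
  by (intro limit_trace_eqI) (simp add: functional_diff[OF seq_positive])

text \<open>Compression agrees with left multiplication by cyclicity and idempotence. Left
  multiplication shows linearity, compression shows positivity, and centrality gives the trace
  identity. The relations hold modulo \<open>J2\<close>, and \<open>tendsto_J2_mult\<close> absorbs
  the errors.\<close>

lemma compressed_trace_facts:
  fixes b
  assumes bnd: "bounded (range b)"
    and sa: "(\<lambda>k. adj (b k) - b k) \<in> J2 \<omega> tracial_states"
    and idem: "(\<lambda>k. b k * b k - b k) \<in> J2 \<omega> tracial_states"
    and central: "\<And>a. (\<lambda>k. b k * a - a * b k) \<in> J2 \<omega> tracial_states"
  defines "\<phi> \<equiv> \<lambda>a. limit_trace \<omega> \<sigma> (\<lambda>k. b k * a)"
  shows limit_trace_compression: "limit_trace \<omega> \<sigma> (\<lambda>k. b k * a * b k) = \<phi> a"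
    and positive_trace_compression: "positive_trace \<phi>"
proof -
  have lim: "((\<lambda>k. \<sigma> k (b k * a)) \<longlongrightarrow> \<phi> a) \<omega>" for a
    unfolding \<phi>_def by (intro tendsto_limit_trace bounded_range_intros bnd)
  have compr: "limit_trace \<omega> \<sigma> (\<lambda>k. b k * a * b k) = \<phi> a" for a
    unfolding \<phi>_def
  proof (rule limit_trace_cong)
    \<comment> \<open>Cyclicity moves the right factor \<open>b k\<close> to the front, where it
      meets the left one.\<close>
    have "\<sigma> k (b k * a * b k - b k * a) = \<sigma> k ((b k * b k - b k) * a)" for k
      using seq_commute[of k "b k * a" "b k"]
      by (simp add: left_diff_distrib functional_diff[OF seq_positive] mult.assoc)
    then show "((\<lambda>k. \<sigma> k (b k * a * b k - b k * a)) \<longlongrightarrow> 0) \<omega>"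
      using tendsto_J2_mult[OF idem bounded_range_const[of a]] by simp
  qed (intro bounded_range_intros bnd)
  show "limit_trace \<omega> \<sigma> (\<lambda>k. b k * a * b k) = \<phi> a" by (rule compr)
  have pos: "Im (\<phi> (adj x * x)) = 0 \<and> 0 \<le> Re (\<phi> (adj x * x))" for x
  proof -
    \<comment> \<open>Replacing the left \<open>b k\<close> by its adjoint makes the argument a
      genuine square of \<open>x * b k\<close>, at the cost of an error controlled by
      \<open>J2\<close>.\<close>
    have "limit_trace \<omega> \<sigma> (\<lambda>k. adj (b k) * (adj x * x) * b k) =
        limit_trace \<omega> \<sigma> (\<lambda>k. b k * (adj x * x) * b k)"
    proof (rule limit_trace_cong)
      show "((\<lambda>k. \<sigma> k (adj (b k) * (adj x * x) * b k - b k * (adj x * x) * b k)) \<longlongrightarrow> 0) \<omega>"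
        using tendsto_J2_mult[OF sa, of "\<lambda>k. (adj x * x) * b k"]
        by (simp add: left_diff_distrib mult.assoc bounded_range_intros bnd)
    qed (intro bounded_range_intros bnd)
    then have "((\<lambda>k. \<sigma> k (adj (b k) * (adj x * x) * b k)) \<longlongrightarrow> \<phi> (adj x * x)) \<omega>"
      using tendsto_limit_trace[of "\<lambda>k. adj (b k) * (adj x * x) * b k"]
      by (simp add: compr bounded_range_intros bnd)
    moreover have "adj (b k) * (adj x * x) * b k = adj (x * b k) * (x * b k)" for k
      by (simp add: adj_mult mult.assoc)
    ultimately have l: "((\<lambda>k. \<sigma> k (adj (x * b k) * (x * b k))) \<longlongrightarrow> \<phi> (adj x * x)) \<omega>"
      by simp
    show ?thesis
    proof
      have "((\<lambda>k. 0) \<longlongrightarrow> Im (\<phi> (adj x * x))) \<omega>"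
        using tendsto_Im[OF l] by (simp only: functional_Im[OF seq_positive])
      then show "Im (\<phi> (adj x * x)) = 0"
        using tendsto_unique[OF ultrafilter_neq_bot[OF \<omega>] _ tendsto_const] by blast
      show "0 \<le> Re (\<phi> (adj x * x))"
        by (rule tendsto_lowerbound[OF tendsto_Re[OF l] _ ultrafilter_neq_bot[OF \<omega>]])
          (simp only: functional_nonneg[OF seq_positive] eventually_True)
    qed
  qed
  show "positive_trace \<phi>"
    unfolding positive_trace_def
  proof (intro conjI allI)
    fix x y c
    show "\<phi> (x + y) = \<phi> x + \<phi> y"
      using tendsto_add[OF lim[of x] lim[of y]]
      by (subst \<phi>_def, intro limit_trace_eqI)
        (simp add: distrib_left functional_add[OF seq_positive])
    show "\<phi> (cscale c x) = c * \<phi> x"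
      using tendsto_mult[OF tendsto_const lim[of x], of c]
      by (subst \<phi>_def, intro limit_trace_eqI)
        (simp add: functional_cscale[OF seq_positive] flip: cscale_mult_right)
    show "Im (\<phi> (adj x * x)) = 0" "0 \<le> Re (\<phi> (adj x * x))" using pos by auto
    show "\<phi> (x * y) = \<phi> (y * x)"
      unfolding \<phi>_def
    proof (rule limit_trace_cong)
      \<comment> \<open>By cyclicity \<open>b k * x * y\<close> has the trace of
        \<open>y * b k * x\<close>, which exposes the commutator of \<open>b k\<close> with
        \<open>y\<close>.\<close>
      have "\<sigma> k (b k * (x * y) - b k * (y * x)) = - \<sigma> k ((b k * y - y * b k) * x)" for k
        using seq_commute[of k "b k * x" y]
        by (simp add: left_diff_distrib functional_diff[OF seq_positive] mult.assoc)
      then show "((\<lambda>k. \<sigma> k (b k * (x * y) - b k * (y * x))) \<longlongrightarrow> 0) \<omega>"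
        using tendsto_minus[OF tendsto_J2_mult[OF central bounded_range_const]] by simp
    qed (intro bounded_range_intros bnd)
  qed
qed

end

section \<open>Extreme tracial states\<close>

lemma positive_functional_eq_0:
  assumes \<phi>: "positive_functional \<phi>" and "\<phi> 1 = 0"
  shows "\<phi> x = 0"
  using functional_Cauchy_Schwarz[OF \<phi>, of 1 x] assms(2) by simp

text \<open>If \<open>t = \<phi> 1\<close> lies strictly between 0 and 1, then \<open>\<tau>\<close>
  is a proper convex combination of the normalized \<open>\<phi>\<close> and \<open>\<psi>\<close>,
  so extremality identifies both with \<open>\<tau>\<close>.\<close>

lemma extreme_trace_dominates:
  fixes \<tau> :: "'a::cstar_algebra \<Rightarrow> complex"
  assumes \<tau>: "\<tau> \<in> extreme_points_fset tracial_states"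
    and \<phi>: "positive_trace \<phi>" and \<psi>: "positive_trace \<psi>" and sum: "\<And>x. \<phi> x + \<psi> x = \<tau> x"
  shows "\<phi> x = \<phi> 1 * \<tau> x"
proof -
  note pf = positive_trace_imp_positive_functional
  define t where "t = Re (\<phi> 1)"
  have t: "\<phi> 1 = of_real t" and t0: "0 \<le> t"
    using functional_Im[OF pf[OF \<phi>], of 1] functional_nonneg[OF pf[OF \<phi>], of 1]
    by (auto simp: t_def complex_eq_iff)
  have "\<tau> 1 = 1"
    using \<tau> by (auto simp: extreme_points_fset_def tracial_states_def tracial_state_def)
  then have s: "\<psi> 1 = of_real (1 - t)" using sum[of 1] t by (simp add: algebra_simps)
  have t1: "t \<le> 1" using functional_nonneg[OF pf[OF \<psi>], of 1] s by simp
  have scaled: "(\<lambda>x. \<theta> x / of_real r) \<in> tracial_states"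
    if "positive_trace \<theta>" "\<theta> 1 = of_real r" "0 < r" for \<theta> :: "'a \<Rightarrow> complex" and r
    using that functional_nonneg[OF pf[OF that(1)]]
    unfolding tracial_states_def tracial_state_def positive_trace_def
    by (auto simp: add_divide_distrib)
  \<comment> \<open>At the end points one of the two normalizations would divide by 0; there
    \<open>\<phi>\<close> or \<open>\<psi>\<close> vanishes at 1, hence everywhere by
    Cauchy-Schwarz.\<close>
  consider "t = 0" | "t = 1" | "0 < t" "t < 1" using t0 t1 by linarith
  then show ?thesis
  proof cases
    case 1
    then show ?thesis using positive_functional_eq_0[OF pf[OF \<phi>]] t by simp
  next
    case 2
    then show ?thesis using positive_functional_eq_0[OF pf[OF \<psi>]] s t sum[of x] by simp
  next
    case 3
    have "\<tau> = (\<lambda>x. of_real t * (\<phi> x / of_real t) + of_real (1 - t) * (\<psi> x / of_real (1 - t)))"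
      using 3 sum by (auto simp flip: of_real_diff simp del: of_real_diff)
    with \<tau> scaled[OF \<phi> t] scaled[OF \<psi> s] 3
    have "(\<lambda>x. \<phi> x / of_real t) = \<tau>"
      unfolding extreme_points_fset_def by fastforce
    then have "\<phi> x / of_real t = \<tau> x" by meson
    then show ?thesis using 3 t by (simp add: field_simps)
  qed
qed

lemma extreme_limit_trace_compression:
  fixes \<sigma> :: "nat \<Rightarrow> 'a::cstar_algebra \<Rightarrow> complex"
  assumes \<omega>: "free_ultrafilter \<omega>"
    and closed: "closed (extreme_points_fset (tracial_states :: ('a \<Rightarrow> complex) set))"
    and ext: "\<And>m. \<sigma> m \<in> extreme_points_fset tracial_states"
    and bnd: "bounded (range b)"
    and sa: "(\<lambda>k. adj (b k) - b k) \<in> J2 \<omega> tracial_states"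
    and idem: "(\<lambda>k. b k * b k - b k) \<in> J2 \<omega> tracial_states"
    and central: "\<And>a. (\<lambda>k. b k * a - a * b k) \<in> J2 \<omega> tracial_states"
  shows "limit_trace \<omega> \<sigma> (\<lambda>k. b k * a * b k) = limit_trace \<omega> \<sigma> b * limit_trace \<omega> \<sigma> (\<lambda>k. a)"
proof -
  have \<sigma>: "\<sigma> m \<in> tracial_states" for m
    using ext[of m] by (simp add: extreme_points_fset_def)
  note bot = ultrafilter_neq_bot[OF \<omega>]
  note lim = tendsto_limit_trace[OF \<omega> \<sigma>]
  define \<phi> where "\<phi> a = limit_trace \<omega> \<sigma> (\<lambda>k. b k * a)" for a
  define \<psi> where "\<psi> a = limit_trace \<omega> \<sigma> (\<lambda>k. (1 - b k) * a)" for a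
  define \<tau> where "\<tau> a = limit_trace \<omega> \<sigma> (\<lambda>k. a)" for a
  have "(\<sigma> \<longlongrightarrow> \<tau>) \<omega>"
    unfolding \<tau>_def by (intro tendsto_fun lim bounded_range_const)
  \<comment> \<open>Closedness of the extreme boundary keeps the ultralimit of extreme states
    extreme.\<close>
  with closed always_eventually bot have \<tau>: "\<tau> \<in> extreme_points_fset tracial_states"
    by (rule Lim_in_closed_set) (intro allI ext)
  have \<phi>: "positive_trace \<phi>"
    unfolding \<phi>_def[abs_def] by (rule positive_trace_compression[OF \<omega> \<sigma> bnd sa idem central])
  \<comment> \<open>\<open>1 - b k\<close> satisfies the relations of \<open>b k\<close> modulo
    \<open>J2\<close>, up to sign.\<close>
  have \<psi>: "positive_trace \<psi>"
    unfolding \<psi>_def[abs_def]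
  proof (rule positive_trace_compression[OF \<omega> \<sigma>])
    show "bounded (range (\<lambda>k. 1 - b k))" by (intro bounded_range_intros bnd)
    show "(\<lambda>k. adj (1 - b k) - (1 - b k)) \<in> J2 \<omega> tracial_states"
      using J2_minus[OF sa] by (simp add: adj_diff)
    show "(\<lambda>k. (1 - b k) * (1 - b k) - (1 - b k)) \<in> J2 \<omega> tracial_states"
      using idem by (simp add: left_diff_distrib right_diff_distrib)
    show "(\<lambda>k. (1 - b k) * a - a * (1 - b k)) \<in> J2 \<omega> tracial_states" for a
      using J2_minus[OF central[of a]] by (simp add: left_diff_distrib right_diff_distrib)
  qed
  have sum: "\<phi> a + \<psi> a = \<tau> a" for a
  proof -
    have "((\<lambda>k. \<sigma> k (b k * a) + \<sigma> k ((1 - b k) * a)) \<longlongrightarrow> \<phi> a + \<psi> a) \<omega>"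
      unfolding \<phi>_def \<psi>_def by (intro tendsto_add lim bounded_range_intros bnd)
    moreover have "\<sigma> k (b k * a) + \<sigma> k ((1 - b k) * a) = \<sigma> k a" for k
      by (simp add: left_diff_distrib functional_diff[OF tracial_state_positive_functional[OF tracial_statesD[OF \<sigma>]]])
    ultimately show ?thesis
      unfolding \<tau>_def by (intro limit_trace_eqI[OF \<omega> \<sigma>, symmetric]) simp
  qed
  have "limit_trace \<omega> \<sigma> (\<lambda>k. b k * a * b k) = \<phi> a"
    unfolding \<phi>_def by (rule limit_trace_compression[OF \<omega> \<sigma> bnd sa idem central])
  also have "\<dots> = \<phi> 1 * \<tau> a" by (rule extreme_trace_dominates[OF \<tau> \<phi> \<psi> sum])
  finally show ?thesis by (simp add: \<phi>_def \<tau>_def)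
qed

section \<open>From extreme to arbitrary tracial states\<close>

theorem theorem4p5:
  fixes D :: "'a::cstar_algebra set" and \<omega> :: "nat filter" and n :: nat
    and p :: "nat \<Rightarrow> nat \<Rightarrow> 'a"
  assumes D: "unital_comm_subalgebra D"
    and bauer: "bauer_simplex (tracial_states :: ('a \<Rightarrow> complex) set)"
    and omega: "free_ultrafilter \<omega>"
    and pD: "\<forall>i\<in>{1..n}. (\<forall>k. p i k \<in> D) \<and> bounded (range (p i))"
    and proj: "\<forall>i\<in>{1..n}. eqJ \<omega> (\<lambda>k. adj (p i k)) (p i) \<and> eqJ \<omega> (\<lambda>k. p i k * p i k) (p i)"
    and orth: "\<forall>i\<in>{1..n}. \<forall>j\<in>{1..n}. i \<noteq> j \<longrightarrow> eqJ \<omega> (\<lambda>k. p i k * p j k) (\<lambda>k. 0)"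
    and sum1: "eqJ \<omega> (\<lambda>k. \<Sum>i=1..n. p i k) (\<lambda>k. 1)"
    and comm: "\<forall>i\<in>{1..n}. \<forall>a. eqJ \<omega> (\<lambda>k. p i k * a) (\<lambda>k. a * p i k)"
    and tr: "\<forall>i\<in>{1..n}. \<forall>\<sigma>. (\<forall>m. \<sigma> m \<in> tracial_states) \<longrightarrow>
               limit_trace \<omega> \<sigma> (p i) = 1 / of_nat n"
  shows "\<forall>i\<in>{1..n}. \<forall>a \<sigma>. (\<forall>m. \<sigma> m \<in> tracial_states) \<longrightarrow>
           limit_trace \<omega> \<sigma> (\<lambda>k. p i k * a * p i k) = 1 / of_nat n * limit_trace \<omega> \<sigma> (\<lambda>k. a)"
proof (intro ballI allI impI)
  fix i a and \<sigma> :: "nat \<Rightarrow> 'a \<Rightarrow> complex"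
  assume i: "i \<in> {1..n}" and "\<forall>m. \<sigma> m \<in> tracial_states"
  then have \<sigma>: "\<sigma> m \<in> tracial_states" for m by blast
  have bnd: "bounded (range (p i))" using pD i by blast
  have K: "compact (tracial_states :: ('a \<Rightarrow> complex) set)"
    and closed: "closed (extreme_points_fset (tracial_states :: ('a \<Rightarrow> complex) set))"
    using bauer by (auto simp: bauer_simplex_def choquet_simplex_def)
  \<comment> \<open>The defect of the claim: along any sequence of tracial states its limit trace is
    the difference of the two sides.\<close>
  define q where "q k = p i k * a * p i k - cscale (1 / of_nat n) a" for k
  have bq: "bounded (range q)"
    unfolding q_def by (intro bounded_range_intros bnd)
  have sub: "limit_trace \<omega> \<rho> q =
      limit_trace \<omega> \<rho> (\<lambda>k. p i k * a * p i k) - 1 / of_nat n * limit_trace \<omega> \<rho> (\<lambda>k. a)"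
    if \<rho>: "\<And>m. \<rho> m \<in> tracial_states" for \<rho>
  proof (rule limit_trace_eqI[OF omega \<rho>])
    have "((\<lambda>k. \<rho> k (p i k * a * p i k) - 1 / of_nat n * \<rho> k a) \<longlongrightarrow>
        limit_trace \<omega> \<rho> (\<lambda>k. p i k * a * p i k) - 1 / of_nat n * limit_trace \<omega> \<rho> (\<lambda>k. a)) \<omega>"
      by (intro tendsto_diff tendsto_mult tendsto_const tendsto_limit_trace[OF omega \<rho>]
          bounded_range_intros bnd)
    then show "((\<lambda>k. \<rho> k (q k)) \<longlongrightarrow>
        limit_trace \<omega> \<rho> (\<lambda>k. p i k * a * p i k) - 1 / of_nat n * limit_trace \<omega> \<rho> (\<lambda>k. a)) \<omega>"
      by (simp only: q_def functional_diff[OF tracial_state_positive_functional[OF tracial_statesD[OF \<rho>]]]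
          functional_cscale[OF tracial_state_positive_functional[OF tracial_statesD[OF \<rho>]]])
  qed
  \<comment> \<open>Multiplication by \<open>cnj L\<close> sends the limit \<open>L\<close> to its
    squared modulus, so a bound on real parts is enough to show \<open>L = 0\<close>.\<close>
  define L where "L = limit_trace \<omega> \<sigma> q"
  \<comment> \<open>The dominating state is chosen anew for each \<open>k\<close>, as
    \<open>q k\<close> varies; the choices form a sequence \<open>e\<close> of extreme
    states.\<close>
  have "\<exists>e. e \<in> extreme_points_fset tracial_states \<and> Re (cnj L * \<sigma> k (q k)) \<le> Re (cnj L * e (q k))" for k
    using Bauer_maximum_principle[OF K \<sigma>] by blast
  then obtain e where e: "\<And>k. e k \<in> extreme_points_fset tracial_states"
    and le: "\<And>k. Re (cnj L * \<sigma> k (q k)) \<le> Re (cnj L * e k (q k))"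
    by metis
  have eT: "e m \<in> tracial_states" for m
    using e[of m] by (simp add: extreme_points_fset_def)
  have "limit_trace \<omega> e (\<lambda>k. p i k * a * p i k) = limit_trace \<omega> e (p i) * limit_trace \<omega> e (\<lambda>k. a)"
    using proj comm i unfolding eqJ_def
    by (intro extreme_limit_trace_compression[OF omega closed e bnd]) auto
  \<comment> \<open>The trace hypothesis holds for every sequence of tracial states, hence also for
    \<open>e\<close>.\<close>
  also have "limit_trace \<omega> e (p i) = 1 / of_nat n" using tr i eT by blast
  finally have "limit_trace \<omega> e q = 0" using sub[of e, OF eT] by simp
  moreover have "((\<lambda>k. e k (q k)) \<longlongrightarrow> limit_trace \<omega> e q) \<omega>"
    by (rule tendsto_limit_trace[OF omega _ bq]) (rule eT)
  ultimately have "((\<lambda>k. Re (cnj L * e k (q k))) \<longlongrightarrow> Re (cnj L * 0)) \<omega>"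
    by (intro tendsto_Re tendsto_mult tendsto_const) simp
  moreover have "((\<lambda>k. Re (cnj L * \<sigma> k (q k))) \<longlongrightarrow> Re (cnj L * L)) \<omega>"
    unfolding L_def by (intro tendsto_Re tendsto_mult tendsto_const tendsto_limit_trace[OF omega \<sigma> bq])
  \<comment> \<open>In the limit the domination reads
    \<open>(cmod L)\<^sup>2 \<le> 0\<close>.\<close>
  ultimately have "Re (cnj L * L) \<le> Re (cnj L * 0)"
    by (rule tendsto_le[OF ultrafilter_neq_bot[OF omega]]) (intro always_eventually allI le)
  moreover have "Re (cnj L * L) = (cmod L)\<^sup>2"
    unfolding cmod_power2 by (simp add: power2_eq_square)
  ultimately have "L = 0" by simp
  then show "limit_trace \<omega> \<sigma> (\<lambda>k. p i k * a * p i k) = 1 / of_nat n * limit_trace \<omega> \<sigma> (\<lambda>k. a)"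
    using sub[of \<sigma>, OF \<sigma>] by (simp add: L_def)
qed

end
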